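(* Let $m\ge 1$, let $\Sigma\subset\{0,1,\dots,m-1\}^{\mathbb{N}}$ be a subshift with shift map $\sigma$, and let $A$ be a continuous function on $\Sigma$ taking $d\times d$ non-negative matrices as values. Let $\nu$ be an ergodic $\sigma$-invariant probability measure on $\Sigma$. Suppose that: (a) there exist $x\in\operatorname{supp}(\nu)$ and an integer $\ell_0\ge1$ such that $A(x)A(\sigma x)\cdots A(\sigma^{\ell_0-1}x)>0$ (all entries strictly positive); (b) there exists $\delta>0$ such that for all $1\le i,j\le d$ and all $y\in\Sigma$, if $A(y)_{i,j}\ne0$ then $A(y)_{i,j}\ge\delta$. Then for any $\nu$-generic point $\omega\in\Sigma$ the limit $$L(\omega)=\lim_{n\to\infty}\frac1n\log\|A(\omega)A(\sigma\omega)\cdots A(\sigma^{n-1}\omega)\|$$ exists in $[-\infty,\infty)$, and the following alternatives hold: (i) there exists $n\in\mathbb{N}$ such that $A(\omega)A(\sigma\omega)\cdots A(\sigma^{n-1}\omega)=0$, so that $L(\omega)=-\infty$; (ii) otherwise, $$L(\omega)=\lim_{n\to\infty}\frac1n\int_\Sigma\log\|A(x)A(\sigma x)\cdots A(\sigma^{n-1}x)\|\,d\nu(x)\in\mathbb{R}.$$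
   Context: Sequences are written $x=(x_n)_{n\ge0}$ and the shift is $\sigma x=(x_{n+1})_{n\ge0}$. A subshift is a (nonempty) closed set $\Sigma\subset\{0,\dots,m-1\}^{\mathbb{N}}$ with $\sigma(\Sigma)\subset\Sigma$. $\operatorname{supp}(\nu)$ is the topological support of $\nu$. A point $\omega$ is $\nu$-generic if $\frac1n\sum_{k=0}^{n-1}\delta_{\sigma^k\omega}\to\nu$ weak-*. For a non-negative matrix $B=(b_{i,j})$, $\|B\|=\sum_{i,j}b_{i,j}$. Convention: $\log 0=-\infty$. *)

theory Defs
  imports "HOL-Probability.Probability"
begin

section \<open>Subshifts and invariant measures\<close>

definition shift :: "(nat \<Rightarrow> 'a) \<Rightarrow> nat \<Rightarrow> 'a" where
  "shift x = (\<lambda>n. x (Suc n))"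

text \<open>Sequences over \<open>{0, \<dots>, m - 1}\<close> are functions \<^typ>\<open>nat \<Rightarrow> nat\<close>; the topology on this type is
  the product of the discrete topologies, in which the full shift is closed, so \<^const>\<open>closed\<close>
  here agrees with closedness relative to the full shift.\<close>

definition subshift :: "nat \<Rightarrow> (nat \<Rightarrow> nat) set \<Rightarrow> bool" where
  "subshift m S \<longleftrightarrow> S \<noteq> {} \<and> S \<subseteq> {x. \<forall>n. x n < m} \<and> closed S \<and> shift ` S \<subseteq> S"

definition invariant_prob :: "(nat \<Rightarrow> nat) set \<Rightarrow> (nat \<Rightarrow> nat) measure \<Rightarrow> bool" where
  "invariant_prob S \<nu> \<longleftrightarrow>
     prob_space \<nu> \<and> sets \<nu> = sets (restrict_space borel S) \<and>
     (\<forall>B\<in>sets \<nu>. emeasure \<nu> (shift -` B \<inter> space \<nu>) = emeasure \<nu> B)"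

definition ergodic_prob :: "(nat \<Rightarrow> nat) set \<Rightarrow> (nat \<Rightarrow> nat) measure \<Rightarrow> bool" where
  "ergodic_prob S \<nu> \<longleftrightarrow>
     invariant_prob S \<nu> \<and>
     (\<forall>B\<in>sets \<nu>. shift -` B \<inter> space \<nu> = B \<longrightarrow> emeasure \<nu> B = 0 \<or> emeasure \<nu> B = 1)"

definition supp :: "'a::topological_space measure \<Rightarrow> 'a set" where
  "supp \<nu> = {x \<in> space \<nu>. \<forall>U. open U \<and> x \<in> U \<longrightarrow> emeasure \<nu> (U \<inter> space \<nu>) > 0}"

section \<open>Generic points\<close>

text \<open>\<open>(1/n) \<Sum>k<n. \<delta>(\<sigma>\<^sup>k \<omega>)\<close> as the push-forward of the uniform distribution on
  \<open>{0, \<dots>, n - 1}\<close> under \<open>k \<mapsto> \<sigma>\<^sup>k \<omega>\<close>; it is meaningful for \<open>n \<ge> 1\<close> only.\<close>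

definition empirical_measure ::
    "(nat \<Rightarrow> nat) set \<Rightarrow> (nat \<Rightarrow> nat) \<Rightarrow> nat \<Rightarrow> (nat \<Rightarrow> nat) measure" where
  "empirical_measure S \<omega> n =
     distr (uniform_count_measure {..<n}) (restrict_space borel S) (\<lambda>k. (shift ^^ k) \<omega>)"

text \<open>Weak-* convergence of finite Borel measures on a compact set \<open>S\<close>.\<close>

definition weak_star_conv ::
    "'a::topological_space set \<Rightarrow> (nat \<Rightarrow> 'a measure) \<Rightarrow> 'a measure \<Rightarrow> bool" where
  "weak_star_conv S \<mu> \<nu> \<longleftrightarrow>
     (\<forall>f::'a \<Rightarrow> real. continuous_on S f \<longrightarrow>
        (\<lambda>n. integral\<^sup>L (\<mu> n) f) \<longlonglongrightarrow> integral\<^sup>L \<nu> f)"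

definition generic ::
    "(nat \<Rightarrow> nat) set \<Rightarrow> (nat \<Rightarrow> nat) measure \<Rightarrow> (nat \<Rightarrow> nat) \<Rightarrow> bool" where
  "generic S \<nu> \<omega> \<longleftrightarrow> \<omega> \<in> S \<and> weak_star_conv S (empirical_measure S \<omega>) \<nu>"

lemma integral_empirical_measure:
  fixes f :: "(nat \<Rightarrow> nat) \<Rightarrow> real"
  assumes "shift ` S \<subseteq> S" "\<omega> \<in> S" "continuous_on S f"
  shows "integral\<^sup>L (empirical_measure S \<omega> n) f = (\<Sum>k<n. f ((shift ^^ k) \<omega>)) / real n"
proof -
  have orbit: "(shift ^^ k) \<omega> \<in> S" for k
    using assms(1,2) by (induction k) auto
  have meas: "(\<lambda>k. (shift ^^ k) \<omega>) \<in>
      measurable (uniform_count_measure {..<n}) (restrict_space borel S)"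
    using orbit by (intro measurableI)
      (auto simp: sets_uniform_count_measure space_uniform_count_measure space_restrict_space)
  have "f \<in> borel_measurable (restrict_space borel S)"
    using assms(3) by (rule borel_measurable_continuous_on_restrict)
  then show ?thesis
    unfolding empirical_measure_def
    by (simp add: integral_distr[OF meas] integral_uniform_count_measure)
qed

section \<open>Products of non-negative matrices\<close>

primrec cocycle ::
    "((nat \<Rightarrow> nat) \<Rightarrow> real^'d^'d) \<Rightarrow> nat \<Rightarrow> (nat \<Rightarrow> nat) \<Rightarrow> real^'d^'d" where
  "cocycle A 0 x = mat 1"
| "cocycle A (Suc n) x = cocycle A n x ** A ((shift ^^ n) x)"

definition entry_norm :: "real^'d^'d \<Rightarrow> real" where
  "entry_norm B = (\<Sum>i\<in>UNIV. \<Sum>j\<in>UNIV. B $ i $ j)"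

section \<open>Extended logarithm and integral\<close>

text \<open>The library logarithm satisfies \<open>ln 0 = 0\<close>, and the Bochner integral is neither defined for
  \<^typ>\<open>ereal\<close>-valued functions nor infinite; both are replaced by extended versions. The integral
  is the usual one (positive part minus negative part) whenever one of the parts is finite.\<close>

definition elog :: "real \<Rightarrow> ereal" where
  "elog t = (if t > 0 then ereal (ln t) else -\<infinity>)"

definition ereal_integral :: "'a measure \<Rightarrow> ('a \<Rightarrow> ereal) \<Rightarrow> ereal" where
  "ereal_integral M f =
     enn2ereal (\<integral>\<^sup>+ x. e2ennreal (max 0 (f x)) \<partial>M) - enn2ereal (\<integral>\<^sup>+ x. e2ennreal (max 0 (- f x)) \<partial>M)"

lemma ereal_integral_ereal:
  fixes f :: "'a \<Rightarrow> real"
  assumes "integrable M f"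
  shows "ereal_integral M (\<lambda>x. ereal (f x)) = ereal (integral\<^sup>L M f)"
proof -
  have part: "enn2ereal (\<integral>\<^sup>+ x. e2ennreal (max 0 (ereal (g x))) \<partial>M) = ereal (enn2real (\<integral>\<^sup>+ x. ennreal (g x) \<partial>M))"
    if "integrable M g" for g :: "'a \<Rightarrow> real"
  proof -
    have "e2ennreal (max 0 (ereal (g x))) = ennreal (g x)" for x
      by (simp add: e2ennreal_def ennreal_def max.commute)
    moreover have "(\<integral>\<^sup>+ x. ennreal (g x) \<partial>M) < \<infinity>"
      using that real_integrable_def[of M g] by (simp add: top.not_eq_extremum)
    ultimately show ?thesis
      by (cases "\<integral>\<^sup>+ x. ennreal (g x) \<partial>M") auto
  qed
  show ?thesis
    using part[OF assms] part[of "\<lambda>x. - f x"] assms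
    by (simp add: ereal_integral_def real_lebesgue_integral_def)
qed

end

theory Submission
  imports Defs
begin

text \<open>
  Dividing \<open>A\<close> by \<open>\<delta>\<close> only shifts the growth rate by \<open>ln \<delta>\<close>, so the non-zero entries may be taken to
  be at least 1. This property passes to products: every entry of every product is 0 or at least 1.
  Consequently the vanishing of a product and the positivity of a product are relatively clopen
  conditions on the base point, and everything below can be expressed by functions that are
  continuous on \<open>S\<close>, to which genericity of \<open>\<omega>\<close> applies.

  If some product along \<open>\<omega>\<close> vanishes, so do all later ones, and the limit is \<open>-\<infinity>\<close>. Suppose that
  none vanishes, and let \<open>f\<^sub>n\<close> be the logarithm of the norm of the \<open>n\<close>-th product, truncated from
  below at 0.

  \<^item> The upper bound rests on the subadditivity and the continuity of \<open>f\<close>. Cutting \<open>[0, n)\<close> into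
    blocks of length \<open>k\<close> and averaging over the \<open>k\<close> positions of the cuts bounds \<open>f\<^sub>n(\<omega>) / n\<close>
    asymptotically by \<open>(\<integral> f\<^sub>k d\<nu>) / k\<close> (\<open>subadditive_average_eventually_le\<close>).

  \<^item> For the lower bound, a block of \<open>l\<close> matrices with positive product decouples what precedes it
    from what follows it. Where no product vanishes, \<open>f\<close> is therefore superadditive at occurrences of
    the block, up to a constant \<open>C\<close> independent of all lengths. Let \<open>\<Psi>\<^sub>n\<close> be the largest value of \<open>f\<close>
    over the pieces of the window \<open>[0, n)\<close> that begin and end at occurrences of the block. Then \<open>\<Psi>\<close>
    is continuous and, along the orbit of \<open>\<omega>\<close>, superadditive up to \<open>2C\<close> (\<open>\<Psi>_superadditive\<close>). The
    same averaging argument, applied to \<open>2C - \<Psi>\<close>, bounds \<open>f\<^sub>n(\<omega>) / n\<close> asymptotically from below by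
    \<open>(\<integral> \<Psi>\<^sub>k d\<nu> - 2C) / k\<close>.

  \<^item> The difference \<open>f\<^sub>k - \<Psi>\<^sub>k\<close> is controlled by the lengths of the parts of the window before the first
    and after the last occurrence of the block. By ergodicity, and because the block has positive
    measure (this uses that it occurs at a point of the support), almost every orbit meets the block.
    Hence \<open>(\<integral> f\<^sub>k d\<nu> - \<integral> \<Psi>\<^sub>k d\<nu>) / k\<close> tends to 0, and both bounds agree in the limit
    (\<open>growth_rate_along_generic_orbit\<close>).

  The truncation is harmless in the integrals as well: since the generic orbit of \<open>\<omega>\<close> never enters
  the clopen set where the \<open>k\<close>-th product vanishes, that set is null (\<open>AE_cocycle_nonzero\<close>).
\<close>

section \<open>Two facts about real sequences\<close>

text \<open>
  The elementary core of the upper bound in the subadditive ergodic theorem. The sliding sum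
  \<open>T n = (\<Sum>i<k. G (n + i) 0)\<close> changes by \<open>G (n + k) 0 - G n 0 \<le> G k n\<close> from \<open>n\<close> to \<open>n + 1\<close>, so it
  is at most \<open>T 0 + (\<Sum>j<n. G k j)\<close>; on the other hand each of its \<open>k\<close> terms is at least
  \<open>G (n + k) 0 - M\<close>. In the applications \<open>G n j\<close> is the value of the \<open>n\<close>-th function of a
  subadditive sequence at the \<open>j\<close>-th point of an orbit.
\<close>

lemma subadditive_le_sum_of_blocks:
  fixes G :: "nat \<Rightarrow> nat \<Rightarrow> real"
  assumes subadd: "\<And>a b j. G (a + b) j \<le> G a j + G b (j + a)"
    and bound: "\<And>i j. i \<le> k \<Longrightarrow> G i j \<le> M"
  shows "real k * G (n + k) 0 \<le> (\<Sum>i<k. G i 0) + real k * M + (\<Sum>j<n. G k j)"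
proof -
  have slide: "(\<Sum>i<k. G (n + i) 0) \<le> (\<Sum>i<k. G i 0) + (\<Sum>j<n. G k j)" for n
  proof (induction n)
    case (Suc n)
    have "(\<Sum>i<k. G (Suc n + i) 0) + G n 0 = (\<Sum>i<Suc k. G (n + i) 0)"
      by (subst sum.lessThan_Suc_shift) simp
    also have "\<dots> = (\<Sum>i<k. G (n + i) 0) + G (n + k) 0"
      by simp
    also have "\<dots> \<le> (\<Sum>i<k. G (n + i) 0) + (G n 0 + G k n)"
      using subadd[of n k 0] by simp
    finally show ?case
      using Suc by simp
  qed simp
  have "real k * G (n + k) 0 = (\<Sum>i<k. G (n + k) 0)"
    by simp
  also have "\<dots> \<le> (\<Sum>i<k. G (n + i) 0 + M)"
  proof (rule sum_mono)
    fix i assume "i \<in> {..<k}"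
    then show "G (n + k) 0 \<le> G (n + i) 0 + M"
      using subadd[of "n + i" "k - i" 0] bound[of "k - i" "n + i"] by simp
  qed
  also have "\<dots> = (\<Sum>i<k. G (n + i) 0) + real k * M"
    by (simp add: sum.distrib)
  finally show ?thesis
    using slide[of n] by simp
qed

lemma subadditive_average_eventually_le:
  fixes G :: "nat \<Rightarrow> nat \<Rightarrow> real"
  assumes subadd: "\<And>a b j. G (a + b) j \<le> G a j + G b (j + a)"
    and bound: "\<And>i j. i \<le> k \<Longrightarrow> G i j \<le> M"
    and average: "(\<lambda>n. (\<Sum>j<n. G k j) / real n) \<longlonglongrightarrow> I"
    and "k \<ge> 1" "\<epsilon> > 0"
  shows "eventually (\<lambda>n. G n 0 / real n \<le> I / real k + \<epsilon>) sequentially"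
proof -
  define C where "C = (\<Sum>i<k. G i 0) + real k * M"
  \<comment> \<open>the bound of the previous lemma for \<open>G (n + k) 0\<close>, divided by \<open>n + k\<close>\<close>
  define R where "R n = (C / real n + (\<Sum>j<n. G k j) / real n) / real k * (real n / real (n + k))" for n
  have ratio: "(\<lambda>n. real n / real (n + k)) \<longlonglongrightarrow> 1"
    by real_asymp
  have "(\<lambda>n. C / real n) \<longlonglongrightarrow> 0"
    by real_asymp
  then have "R \<longlonglongrightarrow> (0 + I) / real k * 1"
    unfolding R_def using \<open>k \<ge> 1\<close> by (intro tendsto_intros average ratio) auto
  then have "eventually (\<lambda>n. R n < I / real k + \<epsilon>) sequentially"
    using \<open>\<epsilon> > 0\<close> by (intro order_tendstoD) auto
  then have "eventually (\<lambda>n. G (n + k) 0 / real (n + k) \<le> I / real k + \<epsilon>) sequentially"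
    using eventually_gt_at_top[of 0]
  proof eventually_elim
    case (elim n)
    have "G (n + k) 0 \<le> (C + (\<Sum>j<n. G k j)) / real k"
      using subadditive_le_sum_of_blocks[of G k M n, OF subadd bound] \<open>k \<ge> 1\<close>
      by (simp add: C_def field_simps)
    then have "G (n + k) 0 / real (n + k) \<le> (C + (\<Sum>j<n. G k j)) / real k / real (n + k)"
      by (intro divide_right_mono) auto
    also have "\<dots> = R n"
      using elim by (simp add: R_def add_divide_distrib[symmetric])
    finally show ?case
      using elim by simp
  qed
  then show ?thesis
    by (rule eventually_sequentially_seg[THEN iffD1])
qed

text \<open>How the upper and the lower bound are combined: a fixed \<open>Y k\<close> close to all late \<open>X n\<close> makes \<open>X\<close>
  a Cauchy sequence, and then the limit of \<open>X\<close> is close to all late \<open>Y k\<close>.\<close>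

lemma mutually_close_imp_common_limit:
  fixes X Y :: "nat \<Rightarrow> real"
  assumes close: "\<And>\<epsilon>. \<epsilon> > 0 \<Longrightarrow>
    eventually (\<lambda>k. eventually (\<lambda>n. \<bar>X n - Y k\<bar> \<le> \<epsilon>) sequentially) sequentially"
  shows "\<exists>c. X \<longlonglongrightarrow> c \<and> Y \<longlonglongrightarrow> c"
proof -
  have "Cauchy X"
  proof (rule metric_CauchyI)
    fix e :: real assume "e > 0"
    have "e / 3 > 0"
      using \<open>e > 0\<close> by simp
    then obtain k where "eventually (\<lambda>n. \<bar>X n - Y k\<bar> \<le> e / 3) sequentially"
      using eventually_happens'[OF sequentially_bot close[of "e / 3"]] by blast
    then obtain N where N: "\<And>n. n \<ge> N \<Longrightarrow> \<bar>X n - Y k\<bar> \<le> e / 3"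
      unfolding eventually_sequentially by blast
    have "dist (X p) (X q) < e" if "p \<ge> N" "q \<ge> N" for p q
    proof -
      have "\<bar>X p - Y k\<bar> \<le> e / 3" "\<bar>X q - Y k\<bar> \<le> e / 3"
        using N that by blast+
      then show ?thesis
        using \<open>e > 0\<close> unfolding dist_real_def by linarith
    qed
    then show "\<exists>N. \<forall>p\<ge>N. \<forall>q\<ge>N. dist (X p) (X q) < e"
      by blast
  qed
  then obtain c where c: "X \<longlonglongrightarrow> c"
    by (auto simp: Cauchy_convergent_iff convergent_def)
  have "Y \<longlonglongrightarrow> c"
  proof (rule tendstoI)
    fix e :: real assume "e > 0"
    have "eventually (\<lambda>k. eventually (\<lambda>n. \<bar>X n - Y k\<bar> \<le> e / 2) sequentially) sequentially"
      using close[of "e / 2"] \<open>e > 0\<close> by simp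
    then show "eventually (\<lambda>k. dist (Y k) c < e) sequentially"
    proof eventually_elim
      case (elim k)
      have "(\<lambda>n. \<bar>X n - Y k\<bar>) \<longlonglongrightarrow> \<bar>c - Y k\<bar>"
        by (intro tendsto_intros c)
      then have "\<bar>c - Y k\<bar> \<le> e / 2"
        using elim by (intro tendsto_upperbound) auto
      then show ?case
        using \<open>e > 0\<close> unfolding dist_real_def by linarith
    qed
  qed
  with c show ?thesis
    by blast
qed

section \<open>Matrices whose entries are zero or at least one\<close>

definition unit_gapped :: "real^'n^'m \<Rightarrow> bool" where
  "unit_gapped M \<longleftrightarrow> (\<forall>i j. M $ i $ j = 0 \<or> 1 \<le> M $ i $ j)"

lemma unit_gapped_nonneg: "unit_gapped M \<Longrightarrow> 0 \<le> M $ i $ j"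
  unfolding unit_gapped_def by (metis order_refl zero_le_one order_trans)

lemma unit_gapped_mat_1: "unit_gapped (mat 1)"
  by (simp add: unit_gapped_def mat_def)

lemma unit_gapped_mult:
  assumes "unit_gapped M" "unit_gapped N"
  shows "unit_gapped (M ** N)"
proof -
  have term_nonneg: "0 \<le> M $ i $ k * N $ k $ j" for i j k
    using assms by (simp add: unit_gapped_nonneg)
  show ?thesis
    unfolding unit_gapped_def
  proof (intro allI disjCI)
    fix i j
    assume "\<not> 1 \<le> (M ** N) $ i $ j"
    then have small: "(\<Sum>k\<in>UNIV. M $ i $ k * N $ k $ j) < 1"
      by (simp add: matrix_matrix_mult_def)
    have "M $ i $ k * N $ k $ j = 0" for k
    proof (rule ccontr)
      assume "M $ i $ k * N $ k $ j \<noteq> 0"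
      then have "1 \<le> M $ i $ k" "1 \<le> N $ k $ j"
        using assms by (auto simp: unit_gapped_def)
      then have "1 * 1 \<le> M $ i $ k * N $ k $ j"
        by (intro mult_mono) auto
      moreover have "M $ i $ k * N $ k $ j \<le> (\<Sum>k\<in>UNIV. M $ i $ k * N $ k $ j)"
        using term_nonneg by (intro member_le_sum) auto
      ultimately show False
        using small by simp
    qed
    then have "(\<Sum>k\<in>UNIV. M $ i $ k * N $ k $ j) = 0"
      by (simp only: sum.neutral_const)
    then show "(M ** N) $ i $ j = 0"
      by (simp add: matrix_matrix_mult_def)
  qed
qed

lemma unit_gapped_entry_norm_ge_1:
  assumes "unit_gapped M" "M \<noteq> 0"
  shows "1 \<le> entry_norm M"
proof -
  obtain i j where "M $ i $ j \<noteq> 0"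
    using \<open>M \<noteq> 0\<close> by (metis vec_eq_iff zero_index)
  then have "1 \<le> M $ i $ j"
    using assms by (auto simp: unit_gapped_def)
  also have "\<dots> \<le> (\<Sum>j\<in>UNIV. M $ i $ j)"
    using assms by (intro member_le_sum) (auto simp: unit_gapped_nonneg)
  also have "\<dots> \<le> entry_norm M"
    unfolding entry_norm_def using assms
    by (intro member_le_sum[where f = "\<lambda>i. \<Sum>j\<in>UNIV. M $ i $ j"])
       (auto intro!: sum_nonneg simp: unit_gapped_nonneg)
  finally show ?thesis .
qed

lemma entry_norm_nonneg:
  assumes "\<And>i j. 0 \<le> M $ i $ j"
  shows "0 \<le> entry_norm M"
  unfolding entry_norm_def using assms by (intro sum_nonneg) auto

lemma entry_norm_mat_1: "entry_norm (mat 1 :: real^'d^'d) = CARD('d)"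
  by (simp add: entry_norm_def mat_def)

lemma entry_norm_scaleR: "entry_norm (c *\<^sub>R M) = c * entry_norm M"
  by (simp add: entry_norm_def sum_distrib_left)

lemma entry_norm_mult_eq:
  "entry_norm (M ** N) = (\<Sum>k\<in>UNIV. (\<Sum>i\<in>UNIV. M $ i $ k) * (\<Sum>j\<in>UNIV. N $ k $ j))"
proof -
  have "entry_norm (M ** N) = (\<Sum>i\<in>UNIV. \<Sum>j\<in>UNIV. \<Sum>k\<in>UNIV. M $ i $ k * N $ k $ j)"
    by (simp add: entry_norm_def matrix_matrix_mult_def)
  also have "\<dots> = (\<Sum>i\<in>UNIV. \<Sum>k\<in>UNIV. \<Sum>j\<in>UNIV. M $ i $ k * N $ k $ j)"
    by (intro sum.cong refl sum.swap)
  also have "\<dots> = (\<Sum>k\<in>UNIV. \<Sum>i\<in>UNIV. \<Sum>j\<in>UNIV. M $ i $ k * N $ k $ j)"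
    by (rule sum.swap)
  finally show ?thesis
    by (simp add: sum_product)
qed

lemma entry_norm_mult_le:
  assumes "\<And>i j. 0 \<le> M $ i $ j" "\<And>i j. 0 \<le> N $ i $ j"
  shows "entry_norm (M ** N) \<le> entry_norm M * entry_norm N"
proof -
  have "entry_norm (M ** N) \<le> (\<Sum>k\<in>UNIV. (\<Sum>i\<in>UNIV. M $ i $ k) * entry_norm N)"
    unfolding entry_norm_mult_eq
  proof (intro sum_mono mult_left_mono)
    fix k
    show "(\<Sum>j\<in>UNIV. N $ k $ j) \<le> entry_norm N"
      unfolding entry_norm_def using assms
      by (intro member_le_sum[where f = "\<lambda>i. \<Sum>j\<in>UNIV. N $ i $ j"]) (auto intro!: sum_nonneg)
  qed (auto intro!: sum_nonneg assms)
  also have "\<dots> = (\<Sum>k\<in>UNIV. \<Sum>i\<in>UNIV. M $ i $ k) * entry_norm N"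
    by (simp add: sum_distrib_right)
  also have "(\<Sum>k\<in>UNIV. \<Sum>i\<in>UNIV. M $ i $ k) = entry_norm M"
    unfolding entry_norm_def by (rule sum.swap)
  finally show ?thesis .
qed

text \<open>A positive factor in the middle decouples its neighbours: every row of \<open>M\<close> is then connected
  to every column of \<open>Q\<close>. This reverses the submultiplicativity of the norm up to a constant.\<close>

lemma entry_norm_mult_positive_middle:
  assumes "\<And>i j. 0 \<le> M $ i $ j" "\<And>i j. 1 \<le> P $ i $ j" "\<And>i j. 0 \<le> Q $ i $ j"
  shows "entry_norm M * entry_norm Q \<le> entry_norm (M ** P ** Q)"
proof -
  define q where "q k = (\<Sum>j\<in>UNIV. Q $ k $ j)" for k
  have q: "0 \<le> q k" for k
    unfolding q_def using assms by (intro sum_nonneg) auto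
  have column: "entry_norm M \<le> (\<Sum>i\<in>UNIV. (M ** P) $ i $ k)" for k
  proof -
    have "M $ i $ j * 1 \<le> M $ i $ j * P $ j $ k" for i j
      using assms by (intro mult_left_mono) auto
    then have "entry_norm M \<le> (\<Sum>i\<in>UNIV. \<Sum>j\<in>UNIV. M $ i $ j * P $ j $ k)"
      unfolding entry_norm_def by (auto intro!: sum_mono)
    then show ?thesis
      by (simp add: matrix_matrix_mult_def)
  qed
  have "entry_norm M * entry_norm Q = (\<Sum>k\<in>UNIV. entry_norm M * q k)"
    by (simp add: entry_norm_def[of Q] q_def sum_distrib_left)
  also have "\<dots> \<le> (\<Sum>k\<in>UNIV. (\<Sum>i\<in>UNIV. (M ** P) $ i $ k) * q k)"
    by (intro sum_mono mult_right_mono column q)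
  also have "\<dots> = entry_norm (M ** P ** Q)"
    by (simp add: entry_norm_mult_eq[of "M ** P"] q_def)
  finally show ?thesis .
qed

section \<open>Subshifts, supports and matrix cocycles\<close>

lemma compact_subshift:
  assumes "subshift m S"
  shows "compact S"
proof -
  have "{x :: nat \<Rightarrow> nat. \<forall>n. x n < m} = PiE UNIV (\<lambda>_. {..<m})"
    by auto
  moreover have "compactin (product_topology (\<lambda>_ :: nat. euclidean :: nat topology) UNIV) (PiE UNIV (\<lambda>_. {..<m}))"
    by (subst compactin_PiE) (simp add: finite_imp_compact)
  ultimately have "compact {x :: nat \<Rightarrow> nat. \<forall>n. x n < m}"
    by (simp add: euclidean_product_topology)
  moreover have "S = {x. \<forall>n. x n < m} \<inter> S" "closed S"
    using assms by (auto simp: subshift_def)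
  ultimately show ?thesis
    by (metis compact_Int_closed)
qed

lemma supp_imp_relatively_open_positive:
  assumes "x \<in> supp \<nu>" "space \<nu> = S" "continuous_on S f" "f x \<in> U" "open U"
  shows "0 < emeasure \<nu> {y \<in> S. f y \<in> U}"
proof -
  have "x \<in> S"
    using assms by (simp add: supp_def)
  obtain V where V: "open V" "V \<inter> S = f -` U \<inter> S"
    using assms(3,5) by (metis continuous_on_open_invariant)
  then have "x \<in> V"
    using \<open>x \<in> S\<close> assms(4) by blast
  then have "0 < emeasure \<nu> (V \<inter> S)"
    using assms(1,2) V(1) by (simp add: supp_def)
  also have "V \<inter> S = {y \<in> S. f y \<in> U}"
    using V(2) by blast
  finally show ?thesis .
qed

lemma ereal_integral_cong_AE:
  assumes "AE x in M. f x = g x"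
  shows "ereal_integral M f = ereal_integral M g"
proof -
  have "(\<integral>\<^sup>+ x. e2ennreal (max 0 (f x)) \<partial>M) = (\<integral>\<^sup>+ x. e2ennreal (max 0 (g x)) \<partial>M)"
    "(\<integral>\<^sup>+ x. e2ennreal (max 0 (- f x)) \<partial>M) = (\<integral>\<^sup>+ x. e2ennreal (max 0 (- g x)) \<partial>M)"
    using assms by (auto intro!: nn_integral_cong_AE elim!: eventually_mono)
  then show ?thesis
    by (simp add: ereal_integral_def)
qed

lemma continuous_on_Max_insert:
  fixes h :: "'i \<Rightarrow> 'a::topological_space \<Rightarrow> real"
  assumes "finite J" "\<And>p. p \<in> J \<Longrightarrow> continuous_on X (h p)"
  shows "continuous_on X (\<lambda>x. Max (insert c ((\<lambda>p. h p x) ` J)))"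
  using assms
proof (induction J)
  case (insert p J)
  have "Max (insert c ((\<lambda>p. h p x) ` insert p J)) = max (h p x) (Max (insert c ((\<lambda>p. h p x) ` J)))" for x
    using insert.hyps by (simp add: insert_commute[of c])
  moreover have "continuous_on X (\<lambda>x. max (h p x) (Max (insert c ((\<lambda>p. h p x) ` J))))"
    using insert by (intro continuous_intros) auto
  ultimately show ?case
    by simp
qed simp

lemma continuous_on_shift_funpow: "continuous_on X (shift ^^ n)"
proof -
  have "(shift ^^ n) x = (\<lambda>i. x (i + n))" for x :: "nat \<Rightarrow> 'a"
    by (induction n arbitrary: x) (auto simp: shift_def funpow_swap1)
  then have "continuous_on X (\<lambda>x. (shift ^^ n) x)"
    by (auto intro!: continuous_on_coordinatewise_then_product continuous_on_subset[OF continuous_on_product_coordinates])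
  then show ?thesis
    by simp
qed

lemma cocycle_add:
  "cocycle B (a + b) x = cocycle B a x ** cocycle B b ((shift ^^ a) x)"
proof (induction b)
  case (Suc b)
  have "(shift ^^ b) ((shift ^^ a) x) = (shift ^^ (a + b)) x"
    by (simp add: add.commute[of a] funpow_add)
  then show ?case
    using Suc by (simp add: matrix_mul_assoc)
qed (simp add: matrix_mul_rid)

lemma cocycle_scaleR: "cocycle (\<lambda>y. c *\<^sub>R A y) n x = c ^ n *\<^sub>R cocycle A n x"
  by (induction n) (auto simp: vec_eq_iff matrix_matrix_mult_def sum_distrib_left algebra_simps)

section \<open>Continuous cocycles with gapped entries\<close>

text \<open>\<open>l\<close> is the length of the blocks whose product is looked for to be positive. The bound on the
  dimension is the norm bound for the empty product, since the identity matrix has entry norm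
  \<open>CARD('d)\<close>; because of it, products of \<open>n\<close> matrices are bounded by \<open>exp (K * (n + 1))\<close>.\<close>

locale gapped_cocycle =
  fixes S :: "(nat \<Rightarrow> nat) set" and B :: "(nat \<Rightarrow> nat) \<Rightarrow> real^'d^'d" and K :: real and l :: nat
  assumes shift_in: "x \<in> S \<Longrightarrow> shift x \<in> S"
    and continuous_B: "continuous_on S B"
    and gapped: "x \<in> S \<Longrightarrow> unit_gapped (B x)"
    and norm_le: "x \<in> S \<Longrightarrow> entry_norm (B x) \<le> exp K"
    and dim_le: "real CARD('d) \<le> exp K"
begin

lemma funpow_in: "x \<in> S \<Longrightarrow> (shift ^^ n) x \<in> S"
  by (induction n) (auto simp: shift_in)

lemma funpow_funpow: "(shift ^^ a) ((shift ^^ b) x) = (shift ^^ (a + b)) x"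
  by (simp add: funpow_add)

lemma continuous_on_comp_shift:
  assumes "continuous_on S f"
  shows "continuous_on S (\<lambda>x. f ((shift ^^ n) x))"
  using assms funpow_in
  by (intro continuous_on_compose2[OF assms continuous_on_shift_funpow]) auto

lemma K_nonneg: "0 \<le> K"
proof -
  have "1 \<le> real CARD('d)"
    by (simp add: Suc_leI)
  then show ?thesis
    using dim_le by (metis exp_le_cancel_iff exp_zero order_trans)
qed

lemma unit_gapped_cocycle:
  assumes "x \<in> S"
  shows "unit_gapped (cocycle B n x)"
proof (induction n)
  case (Suc n)
  then show ?case
    using gapped[OF funpow_in[OF assms, of n]] by (simp add: unit_gapped_mult)
qed (simp add: unit_gapped_mat_1)

lemma cocycle_nonneg: "x \<in> S \<Longrightarrow> 0 \<le> cocycle B n x $ i $ j"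
  by (simp add: unit_gapped_nonneg unit_gapped_cocycle)

lemma B_nonneg: "x \<in> S \<Longrightarrow> 0 \<le> B x $ i $ j"
  by (simp add: unit_gapped_nonneg gapped)

lemma continuous_on_cocycle_entry: "continuous_on S (\<lambda>x. cocycle B n x $ i $ j)"
proof (induction n arbitrary: i j)
  case (Suc n)
  have entry: "continuous_on S (\<lambda>x. B x $ i $ j)" for i j
    by (intro continuous_intros continuous_B)
  have "continuous_on S (\<lambda>x. \<Sum>k\<in>UNIV. cocycle B n x $ i $ k * B ((shift ^^ n) x) $ k $ j)"
    by (intro continuous_on_sum continuous_on_mult Suc continuous_on_comp_shift[OF entry])
  then show ?case
    by (simp add: matrix_matrix_mult_def)
qed simp

lemma continuous_on_norm_cocycle: "continuous_on S (\<lambda>x. entry_norm (cocycle B n x))"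
  unfolding entry_norm_def by (intro continuous_on_sum continuous_on_cocycle_entry)

lemma norm_cocycle_le:
  assumes "x \<in> S"
  shows "entry_norm (cocycle B n x) \<le> exp (K * real (n + 1))"
proof (induction n)
  case (Suc n)
  have "entry_norm (cocycle B (Suc n) x) \<le> entry_norm (cocycle B n x) * entry_norm (B ((shift ^^ n) x))"
    using assms by (auto intro!: entry_norm_mult_le cocycle_nonneg B_nonneg funpow_in)
  also have "\<dots> \<le> exp (K * real (n + 1)) * exp K"
    using assms
    by (intro mult_mono Suc norm_le funpow_in)
       (auto intro!: entry_norm_nonneg B_nonneg funpow_in)
  also have "\<dots> = exp (K * real (Suc n + 1))"
    by (simp add: algebra_simps flip: exp_add)
  finally show ?case .
qed (simp add: entry_norm_mat_1 dim_le)

text \<open>The truncation at 1 turns the value \<open>-\<infinity>\<close> of the logarithm into 0. It makes the function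
  continuous and real-valued on the whole of \<open>S\<close>, keeps it subadditive, and changes nothing where the
  product does not vanish, since the norm is then at least 1.\<close>

definition log_norm :: "nat \<Rightarrow> (nat \<Rightarrow> nat) \<Rightarrow> real" where
  "log_norm n x = ln (max 1 (entry_norm (cocycle B n x)))"

lemma log_norm_nonneg: "0 \<le> log_norm n x"
  by (simp add: log_norm_def)

lemma log_norm_le:
  assumes "x \<in> S"
  shows "log_norm n x \<le> K * real (n + 1)"
proof -
  have "max 1 (entry_norm (cocycle B n x)) \<le> exp (K * real (n + 1))"
    using norm_cocycle_le[OF assms] K_nonneg by simp
  then have "ln (max 1 (entry_norm (cocycle B n x))) \<le> ln (exp (K * real (n + 1)))"
    by (subst ln_le_cancel_iff) (auto simp del: ln_exp)
  then show ?thesis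
    by (simp add: log_norm_def)
qed

lemma continuous_on_log_norm: "continuous_on S (log_norm n)"
  unfolding log_norm_def by (intro continuous_intros continuous_on_norm_cocycle) auto

lemma log_norm_eq_ln:
  assumes "x \<in> S" "cocycle B n x \<noteq> 0"
  shows "log_norm n x = ln (entry_norm (cocycle B n x))"
  using unit_gapped_entry_norm_ge_1[OF unit_gapped_cocycle, of x n] assms
  by (simp add: log_norm_def max_absorb2)

lemma log_norm_subadditive:
  assumes "x \<in> S"
  shows "log_norm (a + b) x \<le> log_norm a x + log_norm b ((shift ^^ a) x)"
proof -
  define p where "p = entry_norm (cocycle B a x)"
  define q where "q = entry_norm (cocycle B b ((shift ^^ a) x))"
  have "0 \<le> p" "0 \<le> q"
    unfolding p_def q_def using assms by (auto intro!: entry_norm_nonneg cocycle_nonneg funpow_in)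
  have "entry_norm (cocycle B (a + b) x) \<le> p * q"
    unfolding p_def q_def cocycle_add
    using assms by (auto intro!: entry_norm_mult_le cocycle_nonneg funpow_in)
  also have "\<dots> \<le> max 1 p * max 1 q"
    using \<open>0 \<le> p\<close> \<open>0 \<le> q\<close> by (intro mult_mono) auto
  finally have "max 1 (entry_norm (cocycle B (a + b) x)) \<le> max 1 p * max 1 q"
    using mult_mono[of 1 "max 1 p" 1 "max 1 q"] by simp
  then have "log_norm (a + b) x \<le> ln (max 1 p * max 1 q)"
    unfolding log_norm_def by (subst ln_le_cancel_iff) (auto intro!: mult_pos_pos)
  also have "\<dots> = log_norm a x + log_norm b ((shift ^^ a) x)"
    by (simp add: ln_mult log_norm_def p_def q_def)
  finally show ?thesis .
qed

text \<open>On \<open>S\<close>, the indicator function of the set of points whose first \<open>l\<close> matrices have a positive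
  product. Because of the gap in the entries it takes only the values 0 and 1, and in this form
  its continuity on \<open>S\<close> is evident.\<close>

definition hit :: "(nat \<Rightarrow> nat) \<Rightarrow> real" where
  "hit x = (\<Prod>i\<in>UNIV. \<Prod>j\<in>UNIV. min 1 (cocycle B l x $ i $ j))"

lemma continuous_on_hit: "continuous_on S hit"
  unfolding hit_def
  by (intro continuous_on_prod continuous_on_min continuous_on_const continuous_on_cocycle_entry)

lemma hit_values:
  assumes "x \<in> S"
  shows "hit x = (if \<forall>i j. 1 \<le> cocycle B l x $ i $ j then 1 else 0)"
proof (cases "\<forall>i j. 1 \<le> cocycle B l x $ i $ j")
  case False
  then obtain i j where "cocycle B l x $ i $ j = 0"
    using unit_gapped_cocycle[OF assms, of l] unfolding unit_gapped_def by blast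
  then have "(\<Prod>j\<in>UNIV. min 1 (cocycle B l x $ i $ j)) = 0"
    by (intro prod_zero) (auto intro!: exI[of _ j])
  then have "hit x = 0"
    unfolding hit_def by (intro prod_zero) (auto intro!: exI[of _ i])
  then show ?thesis
    using False by simp
qed (simp add: hit_def)

lemma hit_eq_1_iff: "x \<in> S \<Longrightarrow> hit x = 1 \<longleftrightarrow> (\<forall>i j. 1 \<le> cocycle B l x $ i $ j)"
  by (simp add: hit_values)

lemma hit_cases: "x \<in> S \<Longrightarrow> hit x = 0 \<or> hit x = 1"
  by (simp add: hit_values)

text \<open>\<open>\<Psi> n x\<close> is the largest logarithmic norm of a partial product that begins at one occurrence of the
  positive block and ends where another one begins, both occurrences lying inside the first \<open>n\<close>
  places; it is 0 if there is no such product. Unlike the logarithmic norm itself it is superadditive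
  up to a constant along orbits where no product vanishes, and it is still a continuous function of
  \<open>x\<close>. The two occurrences may not overlap, because a product can be split at an occurrence only if
  the right factor contains the whole block.\<close>

definition windows :: "nat \<Rightarrow> (nat \<times> nat) set" where
  "windows n = {(a, b). a + l \<le> b \<and> b + l \<le> n}"

definition \<Psi> :: "nat \<Rightarrow> (nat \<Rightarrow> nat) \<Rightarrow> real" where
  "\<Psi> n x = Max (insert 0 ((\<lambda>p. hit ((shift ^^ fst p) x) * hit ((shift ^^ snd p) x) *
     log_norm (snd p - fst p) ((shift ^^ fst p) x)) ` windows n))"

lemma finite_windows: "finite (windows n)"
  by (rule finite_subset[of _ "{..n} \<times> {..n}"]) (auto simp: windows_def)

lemma continuous_on_\<Psi>: "continuous_on S (\<Psi> n)"
  unfolding \<Psi>_def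
  by (intro continuous_on_Max_insert finite_windows continuous_intros continuous_on_comp_shift
      continuous_on_hit continuous_on_log_norm)

lemma \<Psi>_nonneg: "0 \<le> \<Psi> n x"
  unfolding \<Psi>_def using finite_windows by (intro Max_ge) auto

lemma log_norm_le_\<Psi>:
  assumes "a + l \<le> b" "b + l \<le> n" "hit ((shift ^^ a) x) = 1" "hit ((shift ^^ b) x) = 1"
  shows "log_norm (b - a) ((shift ^^ a) x) \<le> \<Psi> n x"
  unfolding \<Psi>_def using assms finite_windows
  by (intro Max_ge) (auto simp: windows_def intro!: image_eqI[of _ _ "(a, b)"])

lemma \<Psi>_cases:
  assumes "x \<in> S"
  obtains "\<Psi> n x = 0"
  | a b where "a + l \<le> b" "b + l \<le> n" "hit ((shift ^^ a) x) = 1" "hit ((shift ^^ b) x) = 1"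
      "\<Psi> n x = log_norm (b - a) ((shift ^^ a) x)"
proof -
  have "\<Psi> n x \<in> insert 0 ((\<lambda>p. hit ((shift ^^ fst p) x) * hit ((shift ^^ snd p) x) *
     log_norm (snd p - fst p) ((shift ^^ fst p) x)) ` windows n)"
    unfolding \<Psi>_def using finite_windows by (intro Max_in) auto
  then consider "\<Psi> n x = 0" | a b where "(a, b) \<in> windows n"
    "\<Psi> n x = hit ((shift ^^ a) x) * hit ((shift ^^ b) x) * log_norm (b - a) ((shift ^^ a) x)"
    by auto
  then show ?thesis
  proof cases
    case (2 a b)
    show ?thesis
    proof (cases "hit ((shift ^^ a) x) = 1 \<and> hit ((shift ^^ b) x) = 1")
      case True
      then show ?thesis
        using 2 that(2)[of a b] by (auto simp: windows_def)
    next
      case False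
      then have "\<Psi> n x = 0"
        using hit_cases[OF funpow_in[OF assms]] 2(2) by (metis mult_eq_0_iff)
      then show ?thesis
        by (rule that(1))
    qed
  qed (rule that(1))
qed

lemma \<Psi>_le:
  assumes "x \<in> S"
  shows "\<Psi> n x \<le> K * real (n + 1)"
  using \<Psi>_cases[OF assms, of n]
proof cases
  case 1
  then show ?thesis
    using K_nonneg by simp
next
  case (2 a b)
  have "log_norm (b - a) ((shift ^^ a) x) \<le> K * real (b - a + 1)"
    using \<open>x \<in> S\<close> by (intro log_norm_le funpow_in)
  also have "\<dots> \<le> K * real (n + 1)"
    using 2 K_nonneg by (intro mult_left_mono) auto
  finally show ?thesis
    using 2 by simp
qed

lemma \<Psi>_mono:
  assumes "x \<in> S" "n \<le> n'"
  shows "\<Psi> n x \<le> \<Psi> n' x"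
  using \<Psi>_cases[OF \<open>x \<in> S\<close>, of n]
proof cases
  case 1
  then show ?thesis
    by (simp add: \<Psi>_nonneg)
next
  case (2 a b)
  then show ?thesis
    using log_norm_le_\<Psi>[of a b n' x] \<open>n \<le> n'\<close> by simp
qed

text \<open>Replacing \<open>x\<close> by \<open>\<sigma>\<^sup>n x\<close> moves a window of length \<open>m\<close> to the end of the window of length
  \<open>n + m\<close>.\<close>

lemma \<Psi>_shift_le:
  assumes "x \<in> S"
  shows "\<Psi> m ((shift ^^ n) x) \<le> \<Psi> (n + m) x"
  using \<Psi>_cases[OF funpow_in[OF assms], of m n]
proof cases
  case 1
  then show ?thesis
    by (simp add: \<Psi>_nonneg)
next
  case (2 a b)
  then show ?thesis
    using log_norm_le_\<Psi>[of "a + n" "b + n" "n + m" x] by (simp add: funpow_funpow)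
qed

lemma log_norm_le_\<Psi>_plus_ends:
  assumes "x \<in> S" "a + l \<le> b" "b + l \<le> n"
    and "hit ((shift ^^ a) x) = 1" "hit ((shift ^^ b) x) = 1"
  shows "log_norm n x \<le> \<Psi> n x + K * (real (a + 1) + real (n - b + 1))"
proof -
  have "log_norm n x \<le> log_norm a x + log_norm (n - a) ((shift ^^ a) x)"
    using log_norm_subadditive[of x a "n - a"] assms by simp
  also have "log_norm (n - a) ((shift ^^ a) x)
      \<le> log_norm (b - a) ((shift ^^ a) x) + log_norm (n - b) ((shift ^^ b) x)"
    using log_norm_subadditive[of "(shift ^^ a) x" "b - a" "n - b"] assms
    by (simp add: funpow_in funpow_funpow)
  finally have "log_norm n x \<le> log_norm a x + log_norm (b - a) ((shift ^^ a) x) + log_norm (n - b) ((shift ^^ b) x)"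
    by simp
  moreover have "log_norm (b - a) ((shift ^^ a) x) \<le> \<Psi> n x"
    using assms by (intro log_norm_le_\<Psi>)
  moreover have "log_norm a x \<le> K * real (a + 1)" "log_norm (n - b) ((shift ^^ b) x) \<le> K * real (n - b + 1)"
    using log_norm_le[OF \<open>x \<in> S\<close>] log_norm_le[OF funpow_in[OF \<open>x \<in> S\<close>]] by blast+
  ultimately show ?thesis
    by (simp only: distrib_left)
qed

text \<open>On \<open>S\<close>, the indicator function of the points at which no positive block begins at any of the first
  \<open>s\<close> places; as a product it is visibly continuous.\<close>

definition avoid :: "nat \<Rightarrow> (nat \<Rightarrow> nat) \<Rightarrow> real" where
  "avoid s x = (\<Prod>k<s. 1 - hit ((shift ^^ k) x))"

lemma continuous_on_avoid: "continuous_on S (avoid s)"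
  unfolding avoid_def by (intro continuous_intros continuous_on_comp_shift continuous_on_hit)

lemma avoid_cases:
  assumes "x \<in> S"
  obtains "avoid s x = 1" | k where "avoid s x = 0" "k < s" "hit ((shift ^^ k) x) = 1"
proof (cases "\<forall>k<s. hit ((shift ^^ k) x) = 0")
  case True
  then have "avoid s x = 1"
    by (simp add: avoid_def)
  then show ?thesis
    by (rule that(1))
next
  case False
  then obtain k where k: "k < s" "hit ((shift ^^ k) x) = 1"
    using hit_cases[OF funpow_in[OF assms]] by blast
  then have "avoid s x = 0"
    unfolding avoid_def by (intro prod_zero) auto
  with k show ?thesis
    by (intro that(2))
qed

lemma avoid_bounds: "x \<in> S \<Longrightarrow> 0 \<le> avoid s x \<and> avoid s x \<le> 1"
  by (rule avoid_cases[of x s]) auto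

text \<open>Why replacing \<open>log_norm\<close> by \<open>\<Psi>\<close> costs little: only the parts before the first and after the
  last occurrence of the positive block are lost, and their lengths are at most \<open>s\<close> and \<open>s + l\<close> unless
  the point or its image under \<open>\<sigma>\<^bsup>n - s - l\<^esup>\<close> avoids the block for \<open>s\<close> steps.\<close>

lemma log_norm_le_\<Psi>_plus_avoid:
  assumes "x \<in> S" "2 * s + 2 * l \<le> n"
  shows "log_norm n x \<le> \<Psi> n x + K * real (2 * s + l + 1)
    + K * real (n + 1) * (avoid s x + avoid s ((shift ^^ (n - s - l)) x))"
proof -
  define c where "c = n - s - l"
  have c: "c + s + l = n" "s + l \<le> c"
    using assms by (auto simp: c_def)
  have nonneg: "0 \<le> avoid s x" "0 \<le> avoid s ((shift ^^ c) x)"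
    using avoid_bounds funpow_in assms(1) by blast+
  consider "avoid s x = 1" | "avoid s ((shift ^^ c) x) = 1" | "avoid s x = 0" "avoid s ((shift ^^ c) x) = 0"
    using avoid_cases[OF assms(1), of s] avoid_cases[OF funpow_in[OF assms(1)], of s c] by metis
  then show ?thesis
  proof cases
    case 3
    obtain a where a: "a < s" "hit ((shift ^^ a) x) = 1"
      using avoid_cases[OF assms(1), of s] 3 by (metis zero_neq_one)
    obtain t where t: "t < s" "hit ((shift ^^ t) ((shift ^^ c) x)) = 1"
      using avoid_cases[OF funpow_in[OF assms(1)], of s c] 3 by (metis zero_neq_one)
    have "log_norm n x \<le> \<Psi> n x + K * (real (a + 1) + real (n - (t + c) + 1))"
      using a t c assms(1) by (intro log_norm_le_\<Psi>_plus_ends) (auto simp: funpow_funpow)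
    also have "K * (real (a + 1) + real (n - (t + c) + 1)) \<le> K * real (2 * s + l + 1)"
      using a t c K_nonneg by (intro mult_left_mono) auto
    finally show ?thesis
      using 3 by (simp add: c_def)
  next
    case 1
    have "K * real (n + 1) * 1 \<le> K * real (n + 1) * (avoid s x + avoid s ((shift ^^ c) x))"
      using 1 nonneg K_nonneg by (intro mult_left_mono) auto
    moreover have "0 \<le> K * real (2 * s + l + 1)"
      using K_nonneg by simp
    ultimately show ?thesis
      using log_norm_le[OF assms(1), of n] \<Psi>_nonneg[of n x] unfolding c_def by linarith
  next
    case 2
    have "K * real (n + 1) * 1 \<le> K * real (n + 1) * (avoid s x + avoid s ((shift ^^ c) x))"
      using 2 nonneg K_nonneg by (intro mult_left_mono) auto
    moreover have "0 \<le> K * real (2 * s + l + 1)"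
      using K_nonneg by simp
    ultimately show ?thesis
      using log_norm_le[OF assms(1), of n] \<Psi>_nonneg[of n x] unfolding c_def by linarith
  qed
qed

subsection \<open>Orbits along which the products never vanish\<close>

definition alive :: "(nat \<Rightarrow> nat) \<Rightarrow> bool" where
  "alive x \<longleftrightarrow> x \<in> S \<and> (\<forall>n. cocycle B n x \<noteq> 0)"

lemma alive_funpow:
  assumes "alive x"
  shows "alive ((shift ^^ j) x)"
proof -
  have "cocycle B n ((shift ^^ j) x) \<noteq> 0" for n
  proof
    assume "cocycle B n ((shift ^^ j) x) = 0"
    then have "cocycle B (j + n) x = 0"
      by (simp add: cocycle_add matrix_matrix_mult_def vec_eq_iff)
    then show False
      using assms by (simp add: alive_def)
  qed
  then show ?thesis
    using assms by (simp add: alive_def funpow_in)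
qed

text \<open>The positive block at place \<open>a\<close> decouples the left factor from what follows the block. The constant
  bounds the contribution of the block itself to the right factor.\<close>

lemma log_norm_superadditive_at_hit:
  assumes x: "alive x" and hit: "hit ((shift ^^ a) x) = 1" and "l \<le> b"
  shows "log_norm a x + log_norm b ((shift ^^ a) x) - K * real (l + 1) \<le> log_norm (a + b) x"
proof -
  define y where "y = (shift ^^ a) x"
  define z where "z = (shift ^^ l) y"
  define q where "q = b - l"
  have alive: "alive y" "alive z"
    using x by (auto simp: y_def z_def alive_funpow)
  have in_S: "x \<in> S" "y \<in> S" "z \<in> S"
    using x alive by (auto simp: alive_def)
  have b: "b = l + q"
    using \<open>l \<le> b\<close> by (simp add: q_def)
  have ge_1: "1 \<le> entry_norm (cocycle B n w)" if "alive w" for n w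
    using that by (auto simp: alive_def intro!: unit_gapped_entry_norm_ge_1 unit_gapped_cocycle)
  have product: "cocycle B (a + b) x = cocycle B a x ** cocycle B l y ** cocycle B q z"
    unfolding b by (simp add: cocycle_add y_def z_def matrix_mul_assoc)
  have "entry_norm (cocycle B a x) * entry_norm (cocycle B q z) \<le> entry_norm (cocycle B (a + b) x)"
    unfolding product using in_S hit hit_eq_1_iff[of y]
    by (intro entry_norm_mult_positive_middle) (auto simp: cocycle_nonneg y_def)
  moreover have "0 < entry_norm (cocycle B a x)" "0 < entry_norm (cocycle B q z)"
    using ge_1[OF x, of a] ge_1[OF alive(2), of q] by auto
  ultimately have "ln (entry_norm (cocycle B a x)) + ln (entry_norm (cocycle B q z))
      \<le> ln (entry_norm (cocycle B (a + b) x))"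
    by (metis ln_mult_pos ln_mono mult_pos_pos)
  then have "log_norm a x + log_norm q z \<le> log_norm (a + b) x"
    using x alive by (simp add: log_norm_eq_ln alive_def)
  moreover have "log_norm b y \<le> log_norm l y + log_norm q z"
    unfolding b z_def using in_S by (intro log_norm_subadditive)
  moreover have "log_norm l y \<le> K * real (l + 1)"
    using in_S by (intro log_norm_le)
  ultimately show ?thesis
    by (simp add: y_def)
qed

lemma \<Psi>_le_log_norm:
  assumes x: "alive x"
  shows "\<Psi> n x - 2 * (K * real (l + 1)) \<le> log_norm n x"
proof -
  have in_S: "x \<in> S"
    using x by (simp add: alive_def)
  show ?thesis
    using \<Psi>_cases[OF in_S, of n]
  proof cases
    case 1
    have "0 \<le> K * real (l + 1)"
      using K_nonneg by simp
    then show ?thesis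
      using 1 log_norm_nonneg[of n x] by linarith
  next
    case (2 a b)
    have "log_norm a x + log_norm (n - a) ((shift ^^ a) x) - K * real (l + 1) \<le> log_norm n x"
      using log_norm_superadditive_at_hit[OF x, of a "n - a"] 2 by simp
    moreover have "log_norm (b - a) ((shift ^^ a) x) + log_norm (n - b) ((shift ^^ b) x) - K * real (l + 1)
        \<le> log_norm (n - a) ((shift ^^ a) x)"
      using log_norm_superadditive_at_hit[OF alive_funpow[OF x, of a], of "b - a" "n - b"] 2
      by (simp add: funpow_funpow)
    ultimately show ?thesis
      using 2(5) log_norm_nonneg[of a x] log_norm_nonneg[of "n - b" "(shift ^^ b) x"] by linarith
  qed
qed

text \<open>Joining an optimal window inside the first \<open>n\<close> places with one inside the following \<open>m\<close> places:
  both junctions are at occurrences of the positive block, so only the constant is lost, and the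
  piece in between contributes a non-negative amount.\<close>

lemma \<Psi>_superadditive:
  assumes x: "alive x"
  shows "\<Psi> n x + \<Psi> m ((shift ^^ n) x) - 2 * (K * real (l + 1)) \<le> \<Psi> (n + m) x"
proof -
  have in_S: "x \<in> S"
    using x by (simp add: alive_def)
  have C: "0 \<le> K * real (l + 1)"
    using K_nonneg by simp
  have left: "\<Psi> n x \<le> \<Psi> (n + m) x" and right: "\<Psi> m ((shift ^^ n) x) \<le> \<Psi> (n + m) x"
    using in_S by (auto intro!: \<Psi>_mono \<Psi>_shift_le)
  show ?thesis
    using \<Psi>_cases[OF in_S, of n]
  proof cases
    case 1
    then show ?thesis
      using C right by linarith
  next
    case (2 a b)
    note first = this
    show ?thesis
      using \<Psi>_cases[OF funpow_in[OF in_S], of m n]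
    proof cases
      case 1
      then show ?thesis
        using C left by linarith
    next
      case (2 a' b')
      define c where "c = n + a'"
      define d where "d = n + b'"
      have hits: "hit ((shift ^^ c) x) = 1" "hit ((shift ^^ d) x) = 1"
        and second: "\<Psi> m ((shift ^^ n) x) = log_norm (d - c) ((shift ^^ c) x)"
        using 2 by (auto simp: c_def d_def funpow_funpow add.commute)
      have order: "a + l \<le> b" "b + l \<le> c" "c + l \<le> d" "d + l \<le> n + m"
        using first 2 by (auto simp: c_def d_def)
      have "log_norm (b - a) ((shift ^^ a) x) + log_norm (d - b) ((shift ^^ b) x) - K * real (l + 1)
          \<le> log_norm (d - a) ((shift ^^ a) x)"
        using log_norm_superadditive_at_hit[OF alive_funpow[OF x, of a], of "b - a" "d - b"] first order
        by (simp add: funpow_funpow)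
      moreover have "log_norm (c - b) ((shift ^^ b) x) + log_norm (d - c) ((shift ^^ c) x) - K * real (l + 1)
          \<le> log_norm (d - b) ((shift ^^ b) x)"
        using log_norm_superadditive_at_hit[OF alive_funpow[OF x, of b], of "c - b" "d - c"] hits order
        by (simp add: funpow_funpow)
      moreover have "log_norm (d - a) ((shift ^^ a) x) \<le> \<Psi> (n + m) x"
        using first hits order by (intro log_norm_le_\<Psi>) auto
      ultimately show ?thesis
        using first(5) second log_norm_nonneg[of "c - b" "(shift ^^ b) x"] by linarith
    qed
  qed
qed

end

section \<open>Ergodicity and generic points\<close>

locale ergodic_gapped_cocycle = gapped_cocycle S B K l
  for S :: "(nat \<Rightarrow> nat) set" and B :: "(nat \<Rightarrow> nat) \<Rightarrow> real^'d^'d" and K :: real and l :: nat +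
  fixes \<nu> :: "(nat \<Rightarrow> nat) measure"
  assumes ergodic: "ergodic_prob S \<nu>"
    and hit_set_positive: "0 < emeasure \<nu> {x \<in> S. hit x = 1}"
begin

sublocale prob_space \<nu>
  using ergodic by (simp add: ergodic_prob_def invariant_prob_def)

lemma sets_\<nu>: "sets \<nu> = sets (restrict_space borel S)"
  using ergodic by (simp add: ergodic_prob_def invariant_prob_def)

lemma space_\<nu>: "space \<nu> = S"
  using sets_eq_imp_space_eq[OF sets_\<nu>] by (simp add: space_restrict_space)

lemma continuous_imp_measurable:
  "continuous_on S f \<Longrightarrow> f \<in> \<nu> \<rightarrow>\<^sub>M (borel :: 'b::topological_space measure)"
  using borel_measurable_continuous_on_restrict[of S f] measurable_cong_sets[OF sets_\<nu> refl] by blast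

lemma continuous_bounded_imp_integrable:
  fixes f :: "(nat \<Rightarrow> nat) \<Rightarrow> real"
  assumes "continuous_on S f" "\<And>x. x \<in> S \<Longrightarrow> 0 \<le> f x" "\<And>x. x \<in> S \<Longrightarrow> f x \<le> M"
  shows "integrable \<nu> f"
  using assms by (intro integrable_const_bound[of f M] continuous_imp_measurable AE_I2) (auto simp: space_\<nu>)

lemma measurable_shift_funpow [measurable]: "shift ^^ n \<in> \<nu> \<rightarrow>\<^sub>M \<nu>"
proof -
  have "shift ^^ n \<in> restrict_space borel S \<rightarrow>\<^sub>M restrict_space borel S"
    using funpow_in
    by (intro measurable_restrict_space2 borel_measurable_continuous_on_restrict continuous_on_shift_funpow)
       (auto simp: space_restrict_space)
  then show ?thesis
    using measurable_cong_sets[OF sets_\<nu> sets_\<nu>] by blast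
qed

lemma distr_shift_funpow: "distr \<nu> \<nu> (shift ^^ n) = \<nu>"
proof (induction n)
  case 0
  then show ?case
    by (simp add: distr_id[unfolded id_def] id_def)
next
  case (Suc n)
  have shift: "shift \<in> \<nu> \<rightarrow>\<^sub>M \<nu>"
    using measurable_shift_funpow[of 1] by simp
  have "distr \<nu> \<nu> shift = \<nu>"
    using ergodic shift
    by (intro measure_eqI) (auto simp: emeasure_distr ergodic_prob_def invariant_prob_def)
  then have "distr \<nu> \<nu> (shift ^^ n) = distr (distr \<nu> \<nu> (shift ^^ n)) \<nu> shift"
    using Suc by simp
  also have "\<dots> = distr \<nu> \<nu> (shift \<circ> shift ^^ n)"
    by (intro distr_distr shift measurable_shift_funpow)
  finally have "distr \<nu> \<nu> (shift \<circ> shift ^^ n) = \<nu>"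
    by (rule trans[OF sym Suc])
  then show ?case
    by (simp only: funpow.simps)
qed

lemma integral_comp_shift:
  fixes f :: "(nat \<Rightarrow> nat) \<Rightarrow> real"
  assumes "f \<in> borel_measurable \<nu>"
  shows "(\<integral>x. f ((shift ^^ n) x) \<partial>\<nu>) = integral\<^sup>L \<nu> f"
  using integral_distr[OF measurable_shift_funpow assms, of n] by (simp add: distr_shift_funpow)

text \<open>The points whose orbit eventually stops meeting the positive block form a strictly invariant
  set, the increasing union of the preimages of the set \<open>never 0\<close> of points whose orbit never
  meets it. By invariance of \<open>\<nu>\<close> all these sets have the same measure, which is 0 or 1 by ergodicity
  and less than 1 because the block itself has positive measure.\<close>

lemma AE_hit: "AE x in \<nu>. \<exists>k. hit ((shift ^^ k) x) = 1"
proof -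
  define never where "never n = {x \<in> space \<nu>. \<forall>k\<in>{n..}. hit ((shift ^^ k) x) = 0}" for n
  define E where "E = (\<Union>n. never n)"
  have hit_measurable [measurable]: "(\<lambda>x. hit ((shift ^^ k) x)) \<in> borel_measurable \<nu>" for k
    by (intro continuous_imp_measurable continuous_on_comp_shift continuous_on_hit)
  have never_sets [measurable]: "never n \<in> sets \<nu>" for n
    unfolding never_def by measurable
  have never_preimage: "never n = (shift ^^ n) -` never 0 \<inter> space \<nu>" for n
  proof (rule set_eqI)
    fix x
    have tail: "(\<forall>k\<ge>n. P k) \<longleftrightarrow> (\<forall>k. P (k + n))" for P :: "nat \<Rightarrow> bool"
      by (metis le_add2 le_add_diff_inverse2)
    have "x \<in> never n \<longleftrightarrow> x \<in> S \<and> (\<forall>k\<ge>n. hit ((shift ^^ k) x) = 0)"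
      by (simp add: never_def space_\<nu> Ball_def)
    also have "\<dots> \<longleftrightarrow> x \<in> S \<and> (\<forall>k. hit ((shift ^^ (k + n)) x) = 0)"
      by (simp only: tail[of "\<lambda>k. hit ((shift ^^ k) x) = 0"])
    also have "\<dots> \<longleftrightarrow> x \<in> (shift ^^ n) -` never 0 \<inter> space \<nu>"
      by (auto simp: never_def space_\<nu> funpow_in funpow_funpow)
    finally show "x \<in> never n \<longleftrightarrow> x \<in> (shift ^^ n) -` never 0 \<inter> space \<nu>" .
  qed
  have same: "emeasure \<nu> (never n) = emeasure \<nu> (never 0)" for n
    using emeasure_distr[OF measurable_shift_funpow[of n] never_sets[of 0]]
    by (simp add: distr_shift_funpow never_preimage[of n])
  have "incseq never"
    by (auto simp: incseq_def never_def)
  then have "emeasure \<nu> E = (SUP n. emeasure \<nu> (never n))"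
    unfolding E_def by (intro SUP_emeasure_incseq[symmetric]) auto
  also have "(\<lambda>n. emeasure \<nu> (never n)) = (\<lambda>_. emeasure \<nu> (never 0))"
    using same by (rule ext)
  finally have E: "emeasure \<nu> E = emeasure \<nu> (never 0)"
    by simp
  have "shift -` E \<inter> space \<nu> = E"
  proof (intro set_eqI iffI)
    fix x assume "x \<in> shift -` E \<inter> space \<nu>"
    then obtain n where x: "x \<in> S" "\<And>k. k \<ge> n \<Longrightarrow> hit ((shift ^^ k) (shift x)) = 0"
      by (auto simp: E_def never_def space_\<nu>)
    have "hit ((shift ^^ k) x) = 0" if "k \<ge> Suc n" for k
      using x(2)[of "k - 1"] that by (cases k) (auto simp del: funpow.simps simp: funpow_Suc_right)
    then have "x \<in> never (Suc n)"
      using x(1) by (auto simp: never_def space_\<nu>)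
    then show "x \<in> E"
      by (auto simp: E_def)
  next
    fix x assume "x \<in> E"
    then obtain n where x: "x \<in> S" "\<And>k. k \<ge> n \<Longrightarrow> hit ((shift ^^ k) x) = 0"
      by (auto simp: E_def never_def space_\<nu>)
    have "hit ((shift ^^ k) (shift x)) = 0" if "k \<ge> n" for k
      using x(2)[of "Suc k"] that by (simp del: funpow.simps add: funpow_Suc_right)
    then have "shift x \<in> never n"
      using x(1) by (auto simp: never_def space_\<nu> shift_in)
    then show "x \<in> shift -` E \<inter> space \<nu>"
      using x(1) by (auto simp: E_def space_\<nu>)
  qed
  moreover have E_sets: "E \<in> sets \<nu>"
    unfolding E_def by auto
  ultimately have zero_one: "emeasure \<nu> E = 0 \<or> emeasure \<nu> E = 1"
    using ergodic by (auto simp: ergodic_prob_def)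
  have hit_set: "{x \<in> S. hit x = 1} \<in> sets \<nu>"
    using hit_measurable[of 0] by (simp add: space_\<nu>[symmetric])
  have "emeasure \<nu> (never 0) \<noteq> 1"
  proof
    assume one: "emeasure \<nu> (never 0) = 1"
    have "never 0 \<inter> {x \<in> S. hit x = 1} = {}"
    proof (rule equals0I)
      fix x assume x: "x \<in> never 0 \<inter> {x \<in> S. hit x = 1}"
      then have "hit ((shift ^^ 0) x) = 0"
        unfolding never_def by blast
      with x show False
        by simp
    qed
    then have "1 + emeasure \<nu> {x \<in> S. hit x = 1} = emeasure \<nu> (never 0 \<union> {x \<in> S. hit x = 1})"
      using plus_emeasure[OF never_sets[of 0] hit_set] one by simp
    also have "\<dots> \<le> 1 + 0"
      using emeasure_le_1 by simp
    finally have "emeasure \<nu> {x \<in> S. hit x = 1} \<le> 0"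
      by (simp only: ennreal_add_left_cancel_le) simp
    then show False
      using hit_set_positive by simp
  qed
  then have "never 0 \<in> null_sets \<nu>"
    using zero_one E never_sets[of 0] by auto
  then show ?thesis
    by (rule AE_I') (use hit_cases[OF funpow_in] in \<open>fastforce simp: never_def space_\<nu>\<close>)
qed

lemma integral_avoid_tendsto_0: "(\<lambda>s. integral\<^sup>L \<nu> (avoid s)) \<longlonglongrightarrow> 0"
proof -
  have "AE x in \<nu>. (\<lambda>s. avoid s x) \<longlonglongrightarrow> 0"
    using AE_hit
  proof eventually_elim
    case (elim x)
    then obtain k where k: "hit ((shift ^^ k) x) = 1"
      by blast
    have "avoid s x = 0" if "s > k" for s
      unfolding avoid_def using that k by (intro prod_zero) auto
    then show ?case
      by (intro tendsto_eventually eventually_mono[OF eventually_gt_at_top[of k]])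
  qed
  moreover have "AE x in \<nu>. norm (avoid s x) \<le> 1" for s
    using avoid_bounds by (intro AE_I2) (simp add: space_\<nu>)
  ultimately have "(\<lambda>s. integral\<^sup>L \<nu> (avoid s)) \<longlonglongrightarrow> (\<integral>x. 0 \<partial>\<nu>)"
    by (intro integral_dominated_convergence[where w = "\<lambda>_. 1"])
       (auto intro!: continuous_imp_measurable continuous_on_avoid)
  then show ?thesis
    by simp
qed

lemma integrable_log_norm: "integrable \<nu> (log_norm n)"
  by (intro continuous_bounded_imp_integrable[of _ "K * real (n + 1)"] continuous_on_log_norm
      log_norm_nonneg log_norm_le)

lemma integrable_\<Psi>: "integrable \<nu> (\<Psi> n)"
  by (intro continuous_bounded_imp_integrable[of _ "K * real (n + 1)"] continuous_on_\<Psi> \<Psi>_nonneg \<Psi>_le)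

lemma integrable_avoid: "integrable \<nu> (\<lambda>x. avoid s ((shift ^^ n) x))"
  using avoid_bounds[OF funpow_in]
  by (intro continuous_bounded_imp_integrable[of _ 1] continuous_on_comp_shift continuous_on_avoid) auto

lemma integral_log_norm_le_\<Psi>:
  assumes "2 * s + 2 * l \<le> n"
  shows "integral\<^sup>L \<nu> (log_norm n) \<le> integral\<^sup>L \<nu> (\<Psi> n) + K * real (2 * s + l + 1)
    + K * real (n + 1) * (2 * integral\<^sup>L \<nu> (avoid s))"
proof -
  note [simp] = integrable_\<Psi> integrable_avoid integrable_avoid[of s 0, simplified]
  have "integral\<^sup>L \<nu> (log_norm n) \<le> (\<integral>x. \<Psi> n x + K * real (2 * s + l + 1)
      + K * real (n + 1) * (avoid s x + avoid s ((shift ^^ (n - s - l)) x)) \<partial>\<nu>)"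
    using log_norm_le_\<Psi>_plus_avoid[OF _ assms]
    by (intro integral_mono integrable_log_norm) (auto simp: space_\<nu>)
  also have "\<dots> = integral\<^sup>L \<nu> (\<Psi> n) + K * real (2 * s + l + 1)
      + K * real (n + 1) * (integral\<^sup>L \<nu> (avoid s) + (\<integral>x. avoid s ((shift ^^ (n - s - l)) x) \<partial>\<nu>))"
    by (simp add: prob_space)
  also have "(\<integral>x. avoid s ((shift ^^ (n - s - l)) x) \<partial>\<nu>) = integral\<^sup>L \<nu> (avoid s)"
    by (intro integral_comp_shift continuous_imp_measurable continuous_on_avoid)
  finally show ?thesis
    by simp
qed

lemma generic_average:
  fixes f :: "(nat \<Rightarrow> nat) \<Rightarrow> real"
  assumes "generic S \<nu> \<omega>" "continuous_on S f"
  shows "(\<lambda>n. (\<Sum>j<n. f ((shift ^^ j) \<omega>)) / real n) \<longlonglongrightarrow> integral\<^sup>L \<nu> f"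
proof -
  have "\<omega> \<in> S" "shift ` S \<subseteq> S"
    using assms shift_in by (auto simp: generic_def)
  then show ?thesis
    using assms by (auto simp: generic_def weak_star_conv_def integral_empirical_measure)
qed

text \<open>By the gap, the points where the \<open>n\<close>-th product vanishes form a relatively clopen set. An orbit
  that avoids this set and is generic forces the set to be null.\<close>

lemma AE_cocycle_nonzero:
  assumes "generic S \<nu> \<omega>" "alive \<omega>"
  shows "AE x in \<nu>. cocycle B n x \<noteq> 0"
proof -
  define h where "h x = max 0 (1 - entry_norm (cocycle B n x))" for x
  have cont: "continuous_on S h"
    unfolding h_def by (intro continuous_intros continuous_on_norm_cocycle)
  have h_bounds: "0 \<le> h x" "h x \<le> 1" if "x \<in> S" for x
    using that entry_norm_nonneg[of "cocycle B n x"] by (auto simp: h_def cocycle_nonneg)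
  have "h ((shift ^^ j) \<omega>) = 0" for j
    using alive_funpow[OF assms(2), of j] unit_gapped_entry_norm_ge_1[OF unit_gapped_cocycle]
    by (auto simp: h_def alive_def)
  then have "(\<lambda>n. 0) \<longlonglongrightarrow> integral\<^sup>L \<nu> h"
    using generic_average[OF assms(1) cont] by simp
  then have "integral\<^sup>L \<nu> h = 0"
    by (simp add: LIMSEQ_const_iff)
  then have "AE x in \<nu>. h x = 0"
    using h_bounds cont
    by (subst (asm) integral_nonneg_eq_0_iff_AE)
       (auto intro!: continuous_bounded_imp_integrable[of _ 1] AE_I2 simp: space_\<nu>)
  then show ?thesis
    by eventually_elim (auto simp: h_def entry_norm_def)
qed

text \<open>Subadditivity of \<open>log_norm\<close> bounds \<open>log_norm n \<omega> / n\<close> from above by its space averages, and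
  superadditivity of \<open>\<Psi>\<close> bounds it from below by the space averages of \<open>\<Psi>\<close>. The two families of
  space averages differ by arbitrarily little because almost every orbit meets the positive
  block.\<close>

theorem growth_rate_along_generic_orbit:
  assumes generic: "generic S \<nu> \<omega>" and alive: "alive \<omega>"
  shows "\<exists>c. (\<lambda>n. log_norm n \<omega> / real n) \<longlonglongrightarrow> c \<and>
    (\<lambda>n. integral\<^sup>L \<nu> (log_norm n) / real n) \<longlonglongrightarrow> c"
proof (rule mutually_close_imp_common_limit)
  fix \<epsilon> :: real assume "\<epsilon> > 0"
  define C where "C = 2 * (K * real (l + 1))"
  have "C \<ge> 0"
    using K_nonneg by (simp add: C_def)
  have in_S: "\<omega> \<in> S"
    using alive by (simp add: alive_def)
  have upper: "eventually (\<lambda>n. log_norm n \<omega> / real n \<le> integral\<^sup>L \<nu> (log_norm k) / real k + \<epsilon>) sequentially"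
    if "k \<ge> 1" for k
  proof -
    define G where "G n j = log_norm n ((shift ^^ j) \<omega>)" for n j
    have "eventually (\<lambda>n. G n 0 / real n \<le> integral\<^sup>L \<nu> (log_norm k) / real k + \<epsilon>) sequentially"
    proof (rule subadditive_average_eventually_le[OF _ _ _ \<open>k \<ge> 1\<close> \<open>\<epsilon> > 0\<close>])
      show "G (a + b) j \<le> G a j + G b (j + a)" for a b j
        using log_norm_subadditive[OF funpow_in[OF in_S, of j], of a b]
        by (simp add: G_def funpow_funpow add.commute)
      show "G i j \<le> K * real (k + 1)" if "i \<le> k" for i j
      proof -
        have "G i j \<le> K * real (i + 1)"
          unfolding G_def using in_S by (intro log_norm_le funpow_in)
        also have "\<dots> \<le> K * real (k + 1)"
          using that K_nonneg by (intro mult_left_mono) auto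
        finally show ?thesis .
      qed
      show "(\<lambda>n. (\<Sum>j<n. G k j) / real n) \<longlonglongrightarrow> integral\<^sup>L \<nu> (log_norm k)"
        unfolding G_def by (intro generic_average generic continuous_on_log_norm)
    qed
    then show ?thesis
      by (simp add: G_def)
  qed
  have lower: "eventually (\<lambda>n. (integral\<^sup>L \<nu> (\<Psi> k) - C) / real k - \<epsilon> / 2 \<le> log_norm n \<omega> / real n) sequentially"
    if "k \<ge> 1" for k
  proof -
    define G where "G n j = C - \<Psi> n ((shift ^^ j) \<omega>)" for n j
    have "eventually (\<lambda>n. G n 0 / real n \<le> (C - integral\<^sup>L \<nu> (\<Psi> k)) / real k + \<epsilon> / 2) sequentially"
    proof (rule subadditive_average_eventually_le[OF _ _ _ \<open>k \<ge> 1\<close>])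
      show "G (a + b) j \<le> G a j + G b (j + a)" for a b j
        using \<Psi>_superadditive[OF alive_funpow[OF alive, of j], of a b]
        by (simp add: G_def C_def funpow_funpow add.commute)
      show "G i j \<le> C" for i j
        by (simp add: G_def \<Psi>_nonneg)
      have "(\<lambda>n. (\<Sum>j<n. C - \<Psi> k ((shift ^^ j) \<omega>)) / real n) \<longlonglongrightarrow> (\<integral>x. C - \<Psi> k x \<partial>\<nu>)"
        by (intro generic_average generic continuous_intros continuous_on_\<Psi>)
      also have "(\<integral>x. C - \<Psi> k x \<partial>\<nu>) = C - integral\<^sup>L \<nu> (\<Psi> k)"
        by (simp add: integrable_\<Psi> prob_space)
      finally show "(\<lambda>n. (\<Sum>j<n. G k j) / real n) \<longlonglongrightarrow> C - integral\<^sup>L \<nu> (\<Psi> k)"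
        by (simp add: G_def)
    qed (use \<open>\<epsilon> > 0\<close> in simp)
    then show ?thesis
    proof eventually_elim
      case (elim n)
      have "- G n 0 / real n \<le> log_norm n \<omega> / real n"
        using \<Psi>_le_log_norm[OF alive, of n] by (intro divide_right_mono) (auto simp: G_def C_def)
      moreover have "(integral\<^sup>L \<nu> (\<Psi> k) - C) / real k = - ((C - integral\<^sup>L \<nu> (\<Psi> k)) / real k)"
        by (simp add: minus_divide_left)
      ultimately show ?case
        using elim by linarith
    qed
  qed
  \<comment> \<open>\<open>s\<close> is fixed before \<open>k\<close>: the loss proportional to \<open>k\<close> is small by the choice of \<open>s\<close>, the
    remaining loss \<open>D\<close> depends on \<open>s\<close> but not on \<open>k\<close>. The factor 4 comes from \<open>k + 1 \<le> 2 * k\<close> and from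
    the two ends of the window.\<close>
  have "(\<lambda>s. 4 * K * integral\<^sup>L \<nu> (avoid s)) \<longlonglongrightarrow> 4 * K * 0"
    by (intro tendsto_intros integral_avoid_tendsto_0)
  then have "eventually (\<lambda>s. 4 * K * integral\<^sup>L \<nu> (avoid s) < \<epsilon> / 4) sequentially"
    using \<open>\<epsilon> > 0\<close> by (intro order_tendstoD) auto
  then obtain s where s: "4 * K * integral\<^sup>L \<nu> (avoid s) < \<epsilon> / 4"
    using eventually_happens'[OF sequentially_bot] by blast
  define D where "D = K * real (2 * s + l + 1) + C"
  have "(\<lambda>k. D / real k) \<longlonglongrightarrow> 0"
    by real_asymp
  then have "eventually (\<lambda>k. D / real k < \<epsilon> / 4) sequentially"
    using \<open>\<epsilon> > 0\<close> by (intro order_tendstoD) auto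
  then show "eventually (\<lambda>k. eventually (\<lambda>n. \<bar>log_norm n \<omega> / real n - integral\<^sup>L \<nu> (log_norm k) / real k\<bar> \<le> \<epsilon>)
      sequentially) sequentially"
    using eventually_ge_at_top[of "2 * s + 2 * l"] eventually_ge_at_top[of 1]
  proof eventually_elim
    case (elim k)
    have "0 \<le> integral\<^sup>L \<nu> (avoid s)"
      using avoid_bounds by (intro integral_nonneg_AE AE_I2) (simp add: space_\<nu>)
    then have "K * real (k + 1) * (2 * integral\<^sup>L \<nu> (avoid s)) \<le> K * (2 * real k) * (2 * integral\<^sup>L \<nu> (avoid s))"
      using elim K_nonneg by (intro mult_right_mono mult_left_mono) auto
    then have "integral\<^sup>L \<nu> (log_norm k)
        \<le> (integral\<^sup>L \<nu> (\<Psi> k) - C) + D + real k * (4 * K * integral\<^sup>L \<nu> (avoid s))"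
      using integral_log_norm_le_\<Psi>[OF elim(2)] by (simp add: D_def algebra_simps)
    then have "integral\<^sup>L \<nu> (log_norm k) / real k
        \<le> ((integral\<^sup>L \<nu> (\<Psi> k) - C) + D + real k * (4 * K * integral\<^sup>L \<nu> (avoid s))) / real k"
      by (intro divide_right_mono) auto
    also have "\<dots> = (integral\<^sup>L \<nu> (\<Psi> k) - C) / real k + D / real k + 4 * K * integral\<^sup>L \<nu> (avoid s)"
      using elim by (simp add: add_divide_distrib)
    finally have close: "integral\<^sup>L \<nu> (log_norm k) / real k \<le> (integral\<^sup>L \<nu> (\<Psi> k) - C) / real k + \<epsilon> / 2"
      using elim s by linarith
    show ?case
      using upper[OF elim(3)] lower[OF elim(3)]
    proof eventually_elim
      case (elim n)
      then show ?case
        using close by linarith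
    qed
  qed
qed

end

section \<open>Growth of products along generic points\<close>

theorem theorem1p3:
  fixes m :: nat
    and S :: "(nat \<Rightarrow> nat) set"
    and A :: "(nat \<Rightarrow> nat) \<Rightarrow> real^'d^'d"
    and \<nu> :: "(nat \<Rightarrow> nat) measure"
    and \<omega> :: "nat \<Rightarrow> nat"
  assumes "m \<ge> 1"
    and "subshift m S"
    and "continuous_on S A"
    and "\<forall>y\<in>S. \<forall>i j. 0 \<le> A y $ i $ j"
    and "ergodic_prob S \<nu>"
    and "\<exists>x\<in>supp \<nu>. \<exists>l\<^sub>0\<ge>1. \<forall>i j. 0 < cocycle A l\<^sub>0 x $ i $ j"
    and "\<exists>\<delta>>0. \<forall>i j. \<forall>y\<in>S. A y $ i $ j \<noteq> 0 \<longrightarrow> A y $ i $ j \<ge> \<delta>"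
    and "generic S \<nu> \<omega>"
  shows "\<exists>L::ereal. L < \<infinity> \<and>
    (\<lambda>n. ereal (1 / real n) * elog (entry_norm (cocycle A n \<omega>))) \<longlonglongrightarrow> L \<and>
    ((\<exists>n\<ge>1. cocycle A n \<omega> = 0) \<longrightarrow> L = -\<infinity>) \<and>
    (\<not> (\<exists>n\<ge>1. cocycle A n \<omega> = 0) \<longrightarrow>
       L \<noteq> -\<infinity> \<and>
       (\<lambda>n. ereal (1 / real n) * ereal_integral \<nu> (\<lambda>x. elog (entry_norm (cocycle A n x)))) \<longlonglongrightarrow> L)"
proof (cases "\<exists>n\<ge>1. cocycle A n \<omega> = 0")
  case True
  then obtain n\<^sub>0 where n\<^sub>0: "cocycle A n\<^sub>0 \<omega> = 0"
    by blast
  have "ereal (1 / real n) * elog (entry_norm (cocycle A n \<omega>)) = -\<infinity>" if "n \<ge> n\<^sub>0" "n > 0" for n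
  proof -
    have "cocycle A n \<omega> = cocycle A (n\<^sub>0 + (n - n\<^sub>0)) \<omega>"
      using that by simp
    also have "\<dots> = 0"
      unfolding cocycle_add n\<^sub>0 by (simp add: matrix_matrix_mult_def vec_eq_iff)
    finally show ?thesis
      using that by (simp add: entry_norm_def elog_def)
  qed
  then have "eventually (\<lambda>n. ereal (1 / real n) * elog (entry_norm (cocycle A n \<omega>)) = -\<infinity>) sequentially"
    by (intro eventually_mono[OF eventually_conj[OF eventually_ge_at_top[of n\<^sub>0] eventually_gt_at_top[of 0]]]) simp
  then have "(\<lambda>n. ereal (1 / real n) * elog (entry_norm (cocycle A n \<omega>))) \<longlonglongrightarrow> -\<infinity>"
    by (rule tendsto_eventually)
  then show ?thesis
    using True by (intro exI[of _ "-\<infinity>"]) auto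
next
  case False
  obtain \<delta> where \<delta>: "\<delta> > 0" "\<And>i j y. y \<in> S \<Longrightarrow> A y $ i $ j \<noteq> 0 \<Longrightarrow> A y $ i $ j \<ge> \<delta>"
    using assms(7) by blast
  obtain x l where x: "x \<in> supp \<nu>" "l \<ge> 1" "\<And>i j. 0 < cocycle A l x $ i $ j"
    using assms(6) by blast
  define B where "B y = (1 / \<delta>) *\<^sub>R A y" for y
  have cocycle_B: "cocycle B n y = (1 / \<delta>) ^ n *\<^sub>R cocycle A n y" for n y
    unfolding B_def by (rule cocycle_scaleR)
  have cocycle_A: "cocycle A n y = \<delta> ^ n *\<^sub>R cocycle B n y" for n y
    using \<delta>(1) by (simp add: cocycle_B power_divide)
  have continuous_B: "continuous_on S B"
    unfolding B_def by (intro continuous_intros assms(3))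
  have "continuous_on S (\<lambda>y. entry_norm (B y))"
    unfolding entry_norm_def by (intro continuous_intros continuous_B)
  then have "bounded ((\<lambda>y. entry_norm (B y)) ` S)"
    by (intro compact_imp_bounded compact_continuous_image compact_subshift[OF assms(2)])
  then obtain M where M: "\<And>y. y \<in> S \<Longrightarrow> \<bar>entry_norm (B y)\<bar> \<le> M"
    by (auto simp: bounded_iff)
  define K where "K = ln (max (real CARD('d)) M)"
  have "real CARD('d) > 0"
    by simp
  then have exp_K: "exp K = max (real CARD('d)) M"
    unfolding K_def by (intro exp_ln) linarith
  interpret gapped_cocycle S B K l
  proof
    show "shift y \<in> S" if "y \<in> S" for y
      using that assms(2) by (auto simp: subshift_def)
    show "unit_gapped (B y)" if "y \<in> S" for y
      using \<delta> that by (fastforce simp: unit_gapped_def B_def field_simps)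
    show "entry_norm (B y) \<le> exp K" if "y \<in> S" for y
      using M[OF that] by (simp add: exp_K)
  qed (use continuous_B x exp_K in auto)
  have space: "space \<nu> = S"
    using assms(5) sets_eq_imp_space_eq[of \<nu> "restrict_space borel S"]
    by (simp add: ergodic_prob_def invariant_prob_def space_restrict_space)
  have "x \<in> S"
    using x(1) space by (simp add: supp_def)
  have "cocycle B l x $ i $ j \<noteq> 0" for i j
    using x(3)[of i j] \<delta>(1) by (simp add: cocycle_B)
  then have "hit x = 1"
    using unit_gapped_cocycle[OF \<open>x \<in> S\<close>, of l] by (auto simp: hit_eq_1_iff[OF \<open>x \<in> S\<close>] unit_gapped_def)
  then have "0 < emeasure \<nu> {y \<in> S. hit y \<in> {0<..}}"
    by (intro supp_imp_relatively_open_positive[OF x(1) space continuous_on_hit]) auto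
  \<comment> \<open>\<open>hit\<close> takes no values strictly between 0 and 1, so the open condition is the closed one\<close>
  also have "{y \<in> S. hit y \<in> {0<..}} = {y \<in> S. hit y = 1}"
    using hit_cases by force
  finally interpret ergodic_gapped_cocycle S B K l \<nu>
    by unfold_locales (rule assms(5))
  have elog_A: "elog (entry_norm (cocycle A n y)) = ereal (log_norm n y + real n * ln \<delta>)"
    if "y \<in> S" "cocycle B n y \<noteq> 0" for n y
  proof -
    have "1 \<le> entry_norm (cocycle B n y)"
      using that by (intro unit_gapped_entry_norm_ge_1 unit_gapped_cocycle)
    then show ?thesis
      using that \<delta>(1)
      by (simp add: cocycle_A entry_norm_scaleR elog_def log_norm_eq_ln ln_mult_pos ln_realpow)
  qed
  have "cocycle A n \<omega> \<noteq> 0" for n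
  proof (cases n)
    case 0
    then show ?thesis
      by (simp add: vec_eq_iff mat_def)
  qed (use False in auto)
  then have alive: "alive \<omega>"
    using assms(8) \<delta>(1) by (simp add: alive_def generic_def cocycle_B)
  have integral_A: "ereal_integral \<nu> (\<lambda>y. elog (entry_norm (cocycle A n y)))
      = ereal (integral\<^sup>L \<nu> (log_norm n) + real n * ln \<delta>)" for n
  proof -
    have "AE y in \<nu>. elog (entry_norm (cocycle A n y)) = ereal (log_norm n y + real n * ln \<delta>)"
      using AE_cocycle_nonzero[OF assms(8) alive, of n] AE_space
      by eventually_elim (auto simp: space elog_A)
    then have "ereal_integral \<nu> (\<lambda>y. elog (entry_norm (cocycle A n y)))
        = ereal_integral \<nu> (\<lambda>y. ereal (log_norm n y + real n * ln \<delta>))"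
      by (rule ereal_integral_cong_AE)
    also have "\<dots> = ereal (\<integral>y. log_norm n y + real n * ln \<delta> \<partial>\<nu>)"
      by (intro ereal_integral_ereal) (simp add: integrable_log_norm)
    also have "(\<integral>y. log_norm n y + real n * ln \<delta> \<partial>\<nu>) = integral\<^sup>L \<nu> (log_norm n) + real n * ln \<delta>"
      by (simp add: integrable_log_norm prob_space)
    finally show ?thesis .
  qed
  have normalize: "(\<lambda>n. ereal (1 / real n) * ereal (f n + real n * ln \<delta>)) \<longlonglongrightarrow> ereal (c + ln \<delta>)"
    if "(\<lambda>n. f n / real n) \<longlonglongrightarrow> c" for f c
  proof -
    have "(\<lambda>n. ereal (f n / real n + ln \<delta>)) \<longlonglongrightarrow> ereal (c + ln \<delta>)"
      by (intro tendsto_intros that)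
    moreover have "eventually (\<lambda>n. ereal (f n / real n + ln \<delta>) = ereal (1 / real n) * ereal (f n + real n * ln \<delta>)) sequentially"
      using eventually_gt_at_top[of 0] by eventually_elim (simp add: field_simps)
    ultimately show ?thesis
      by (rule Lim_transform_eventually)
  qed
  obtain c where c: "(\<lambda>n. log_norm n \<omega> / real n) \<longlonglongrightarrow> c"
      "(\<lambda>n. integral\<^sup>L \<nu> (log_norm n) / real n) \<longlonglongrightarrow> c"
    using growth_rate_along_generic_orbit[OF assms(8) alive] by blast
  have "elog (entry_norm (cocycle A n \<omega>)) = ereal (log_norm n \<omega> + real n * ln \<delta>)" for n
    using alive by (intro elog_A) (auto simp: alive_def)
  then show ?thesis
    using False normalize[OF c(1)] normalize[OF c(2)]
    by (intro exI[of _ "ereal (c + ln \<delta>)"]) (simp add: integral_A)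
qed

end
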